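(* Let $a_1,\ldots,a_m,b_1,\ldots,b_m$ be nonnegative integers and let $n$ be a positive integer. Then $$\sum_{k=0}^{n-1} \binom{n-1}{k}^2\prod_{i=1}^m \binom{a_i+k}{b_i+k} \equiv 0 \pmod{\gcd(a_1,\ldots,a_m,b_1,\ldots,b_m,n)}.$$
   Context: For nonnegative integers $N,K$, $\binom{N}{K}$ is the usual binomial coefficient, equal to $0$ when $K>N$. *)

theory Defs
  imports "HOL-Number_Theory.Cong"
begin

end

(* The proof passes to a q-analogue. With Gaussian binomials put
     F(q) = sum over k of q^(k^2 + 2k) [n-1, k]^2 prod_i [a_i + k, b_i + k],
   an integer polynomial whose value at q = 1 is the sum in question. Let g be the gcd. If z is a
   g-th root of unity of order d > 1, then d divides n and all a_i, b_i, and the q-Lucas theorem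
   factors F(z) into a sum over k div d times the sum over t = k mod d of
   z^(t^2 + 2t) [d-1, t]^2 = z^t, which vanishes. Hence F(1) is the sum of F over all g-th roots
   of unity, i.e. g times the sum of the coefficients of F at multiples of g. *)

theory Submission
  imports Defs "HOL-Computational_Algebra.Polynomial"
begin

section \<open>Gaussian binomial coefficients\<close>

text \<open>Defining by the q-Pascal rule avoids division, so \<open>q\<close> may be a polynomial
  variable or a root of unity, where the quotient formula would degenerate.\<close>

fun qbinomial :: "'a::comm_semiring_1 \<Rightarrow> nat \<Rightarrow> nat \<Rightarrow> 'a" where
  "qbinomial q n 0 = 1"
| "qbinomial q 0 (Suc k) = 0"
| "qbinomial q (Suc n) (Suc k) = qbinomial q n k + q ^ Suc k * qbinomial q n (Suc k)"

lemma qbinomial_eq_0: "n < k \<Longrightarrow> qbinomial q n k = 0"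
  by (induction q n k rule: qbinomial.induct) auto

lemma qbinomial_self: "qbinomial q n n = 1"
  by (induction n) (auto simp: qbinomial_eq_0)

lemma qbinomial_1: "qbinomial 1 n k = of_nat (n choose k)"
  by (induction "1::'a" n k rule: qbinomial.induct) auto

lemma poly_qbinomial: "poly (qbinomial p n k) x = qbinomial (poly p x) n k"
  by (induction p n k rule: qbinomial.induct) auto

lemma one_minus_mult:
  fixes u v x :: "'a::comm_ring_1"
  shows "(1 - u) * x + u * ((1 - v) * x) = (1 - u * v) * x"
  by (simp add: algebra_simps)

text \<open>The ratio identity is a premise here so that the induction proving it can already use
  absorption for the same row.\<close>

lemma qbinomial_absorb_if_ratio:
  fixes q :: "'a::comm_ring_1"
  assumes "k \<le> n"
    and ratio: "(1 - q ^ Suc k) * qbinomial q n (Suc k) = (1 - q ^ (n - k)) * qbinomial q n k"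
  shows "(1 - q ^ Suc k) * qbinomial q (Suc n) (Suc k) = (1 - q ^ Suc n) * qbinomial q n k"
proof -
  have qn: "q ^ Suc k * q ^ (n - k) = q ^ Suc n"
    using assms(1) by (simp del: power_Suc flip: power_add)
  have "(1 - q ^ Suc k) * qbinomial q (Suc n) (Suc k) =
      (1 - q ^ Suc k) * qbinomial q n k
      + q ^ Suc k * ((1 - q ^ Suc k) * qbinomial q n (Suc k))"
    by (simp add: distrib_left mult.left_commute del: power_Suc)
  then show ?thesis
    unfolding ratio one_minus_mult qn .
qed

text \<open>In row \<open>Suc n\<close> with \<open>k = Suc j\<close>, both sides reduce to
  \<open>(1 - q ^ Suc n) * qbinomial q n k\<close>: the left by absorption, the right by q-Pascal
  and the induction hypothesis at \<open>j\<close> read backwards.\<close>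

lemma qbinomial_ratio:
  fixes q :: "'a::comm_ring_1"
  assumes "k \<le> n"
  shows "(1 - q ^ Suc k) * qbinomial q n (Suc k) = (1 - q ^ (n - k)) * qbinomial q n k"
  using assms
proof (induction n arbitrary: k)
  case 0
  then show ?case by simp
next
  case (Suc n)
  have absorb: "(1 - q ^ Suc j) * qbinomial q (Suc n) (Suc j) = (1 - q ^ Suc n) * qbinomial q n j"
    if "j \<le> n" for j
    using that Suc.IH[OF that] by (rule qbinomial_absorb_if_ratio)
  show ?case
  proof (cases k)
    case 0
    then show ?thesis using absorb[of 0] by simp
  next
    case (Suc j)
    with Suc.prems have j: "j \<le> n" by simp
    have qn: "q ^ Suc j * q ^ (n - j) = q ^ Suc n"
      using j by (simp del: power_Suc flip: power_add)
    have "(1 - q ^ (n - j)) * qbinomial q (Suc n) (Suc j) =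
        (1 - q ^ (n - j)) * qbinomial q n j
        + q ^ Suc j * ((1 - q ^ (n - j)) * qbinomial q n (Suc j))"
      by (simp add: distrib_left mult.left_commute del: power_Suc)
    then have *: "(1 - q ^ (n - j)) * qbinomial q (Suc n) (Suc j) =
        (1 - q ^ Suc n) * qbinomial q n (Suc j)"
      unfolding Suc.IH[OF j, symmetric] one_minus_mult qn .
    show ?thesis
    proof (cases "k \<le> n")
      case True
      then show ?thesis using absorb[OF True] * Suc by simp
    next
      case False
      then have "k = Suc n" using Suc.prems by simp
      then show ?thesis by (simp add: qbinomial_eq_0)
    qed
  qed
qed

lemma qbinomial_absorb:
  fixes q :: "'a::comm_ring_1"
  assumes "k \<le> n"
  shows "(1 - q ^ Suc k) * qbinomial q (Suc n) (Suc k) = (1 - q ^ Suc n) * qbinomial q n k"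
  using assms qbinomial_ratio[OF assms] by (rule qbinomial_absorb_if_ratio)

section \<open>Evaluation at roots of unity\<close>

locale root_of_unity =
  fixes z :: "'a::idom" and d :: nat
  assumes power_order: "z ^ d = 1"
    and order_pos: "0 < d"
    and order_minimal: "\<And>j. 0 < j \<Longrightarrow> j < d \<Longrightarrow> z ^ j \<noteq> 1"
begin

lemma power_mod_order: "z ^ n = z ^ (n mod d)"
proof -
  have "z ^ n = z ^ (d * (n div d) + n mod d)" by simp
  also have "\<dots> = z ^ (n mod d)" unfolding power_add power_mult by (simp add: power_order)
  finally show ?thesis .
qed

lemma order_dvd: "z ^ n = 1 \<Longrightarrow> d dvd n"
  using power_mod_order[of n] order_minimal[of "n mod d"] order_pos
  by (cases "n mod d = 0") auto

text \<open>In the absorption identity the factor \<open>1 - z ^ d\<close> vanishes while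
  \<open>1 - z ^ k\<close> does not, and there are no zero divisors.\<close>

lemma qbinomial_order_eq_0:
  assumes "0 < k" "k < d"
  shows "qbinomial z d k = 0"
proof -
  obtain j where k: "k = Suc j" using assms(1) gr0_implies_Suc by blast
  obtain e where d: "d = Suc e" using order_pos gr0_implies_Suc by blast
  have "(1 - z ^ k) * qbinomial z d k = (1 - z ^ d) * qbinomial z e j"
    unfolding k d using assms(2) by (intro qbinomial_absorb) (simp add: k d)
  then show ?thesis using order_minimal[OF assms] power_order by simp
qed

text \<open>Induction along the q-Pascal rule, tracking quotient and remainder modulo
  \<open>d\<close> of both arguments.\<close>

theorem q_Lucas:
  "qbinomial z n k = of_nat ((n div d) choose (k div d)) * qbinomial z (n mod d) (k mod d)"
proof (induction n arbitrary: k)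
  case 0
  show ?case
  proof (cases "k mod d")
    case 0
    with order_pos show ?thesis
      by (cases "k div d = 0"; cases k) (auto simp: binomial_eq_0)
  next
    case (Suc j)
    then show ?thesis by (cases k) auto
  qed
next
  case (Suc n)
  show ?case
  proof (cases k)
    case 0
    then show ?thesis by simp
  next
    case k: (Suc j)
    define a s b t where defs: "a = n div d" "s = n mod d" "b = j div d" "t = j mod d"
    have st: "s < d" "t < d" using order_pos defs by auto
    have n: "Suc n div d = (if Suc s = d then Suc a else a)"
        "Suc n mod d = (if Suc s = d then 0 else Suc s)"
      unfolding defs by (simp_all add: div_Suc mod_Suc)
    have j: "Suc j div d = (if Suc t = d then Suc b else b)"
        "Suc j mod d = (if Suc t = d then 0 else Suc t)"
      unfolding defs by (simp_all add: div_Suc mod_Suc)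
    have zj: "z ^ Suc j = (if Suc t = d then 1 else z ^ Suc t)"
      by (subst power_mod_order) (simp add: j)
    have rec: "qbinomial z (Suc n) k =
        of_nat (a choose b) * qbinomial z s t
        + z ^ Suc j * (of_nat (a choose (Suc j div d)) * qbinomial z s (Suc j mod d))"
      unfolding k qbinomial.simps Suc.IH[of j] Suc.IH[of "Suc j"] by (simp add: defs)
    \<comment> \<open>The cases record which remainder wraps around to 0. With no wrap, q-Pascal
      acts on the remainders; when both wrap, ordinary Pascal acts on the quotients.\<close>
    consider "Suc s \<noteq> d" "Suc t \<noteq> d" | "Suc s \<noteq> d" "Suc t = d"
      | "Suc s = d" "Suc t \<noteq> d" | "Suc s = d" "Suc t = d" by blast
    then show ?thesis
    proof cases
      case 1
      then show ?thesis unfolding rec by (simp add: k n j zj algebra_simps del: power_Suc)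
    next
      case 2
      then have "s < t" using st by simp
      then show ?thesis using 2 unfolding rec by (simp add: k n j zj qbinomial_eq_0 del: power_Suc)
    next
      case 3
      \<comment> \<open>Only the upper remainder wraps: the two q-Pascal terms add up to an inner
        entry of row \<open>d\<close>, which is zero.\<close>
      then have "qbinomial z (Suc s) (Suc t) = 0"
        using qbinomial_order_eq_0[of "Suc t"] st by simp
      then have "qbinomial z s t + z ^ Suc t * qbinomial z s (Suc t) = 0" by simp
      then have "of_nat (a choose b) * (qbinomial z s t + z ^ Suc t * qbinomial z s (Suc t)) = 0"
        by simp
      then show ?thesis using 3 unfolding rec
        by (simp add: k n j zj algebra_simps del: power_Suc)
    next
      case 4
      then have "s = t" by simp
      then have "qbinomial z s t = 1" by (simp add: qbinomial_self)
      then show ?thesis using 4 unfolding rec by (simp add: k n j zj del: power_Suc)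
    qed
  qed
qed

text \<open>Since inner entries of row \<open>d\<close> vanish, neighbours in row
  \<open>d - 1\<close> differ by a power of \<open>z\<close> and a sign. Squaring removes the sign,
  and the exponent \<open>t * Suc t\<close> normalises the square to 1; the surplus \<open>t\<close>
  in \<open>t^2 + 2 * t\<close> leaves \<open>z ^ t\<close>.\<close>

lemma qbinomial_pred_order_square:
  assumes "t < d"
  shows "z ^ (t\<^sup>2 + 2 * t) * (qbinomial z (d - 1) t)\<^sup>2 = z ^ t"
proof -
  have "z ^ (t * Suc t) * (qbinomial z (d - 1) t)\<^sup>2 = 1"
    using assms
  proof (induction t)
    case 0
    then show ?case by simp
  next
    case (Suc t)
    have "qbinomial z (Suc (d - 1)) (Suc t) = 0"
      using qbinomial_order_eq_0[of "Suc t"] Suc.prems by simp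
    then have "z ^ Suc t * qbinomial z (d - 1) (Suc t) = - qbinomial z (d - 1) t"
      by (simp add: add_eq_0_iff)
    then have "(z ^ Suc t * qbinomial z (d - 1) (Suc t))\<^sup>2 = (qbinomial z (d - 1) t)\<^sup>2"
      by simp
    moreover have "z ^ (Suc t * Suc (Suc t)) = z ^ (t * Suc t) * (z ^ Suc t)\<^sup>2"
      by (simp add: power2_eq_square algebra_simps del: power_Suc flip: power_add)
    ultimately show ?case using Suc by (simp add: power_mult_distrib mult.assoc)
  qed
  moreover have "z ^ (t\<^sup>2 + 2 * t) = z ^ t * z ^ (t * Suc t)"
    unfolding power_add[symmetric] by (rule arg_cong[where f = "power z"]) (simp add: power2_eq_square)
  ultimately show ?thesis by (simp add: mult.assoc)
qed

end

lemma root_of_unity_exists: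
  fixes z :: "'a::idom"
  assumes "z ^ n = 1" "0 < n"
  obtains d where "root_of_unity z d"
proof
  let ?d = "LEAST e. 0 < e \<and> z ^ e = 1"
  have "0 < ?d \<and> z ^ ?d = 1"
    using assms LeastI[of "\<lambda>e. 0 < e \<and> z ^ e = 1" n] by blast
  moreover have "z ^ j \<noteq> 1" if "0 < j" "j < ?d" for j
    using not_less_Least[OF that(2)] that(1) by blast
  ultimately show "root_of_unity z ?d"
    unfolding root_of_unity_def by blast
qed

section \<open>The q-analogue of the sum\<close>

text \<open>Polymorphic in \<open>q\<close>, so that one definition yields the polynomial F at the
  variable and its values at numbers.\<close>

definition qsum :: "(nat \<Rightarrow> nat) \<Rightarrow> (nat \<Rightarrow> nat) \<Rightarrow> nat \<Rightarrow> nat \<Rightarrow> 'a::comm_semiring_1 \<Rightarrow> 'a" where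
  "qsum a b m n q = (\<Sum>k<n. q ^ (k\<^sup>2 + 2 * k) * (qbinomial q (n - 1) k)\<^sup>2 *
                        (\<Prod>i=1..m. qbinomial q (a i + k) (b i + k)))"

lemma qsum_1:
  "qsum a b m n 1 =
    of_nat (\<Sum>k<n. ((n - 1) choose k)\<^sup>2 * (\<Prod>i=1..m. (a i + k) choose (b i + k)))"
  by (simp add: qsum_def qbinomial_1)

lemma poly_qsum: "poly (qsum a b m n p) x = qsum a b m n (poly p x)"
  by (simp add: qsum_def poly_sum poly_prod poly_qbinomial)

lemma (in root_of_unity) qsum_eq_0:
  assumes "z \<noteq> 1" "d dvd n" "\<And>i. i \<in> {1..m} \<Longrightarrow> d dvd a i" "\<And>i. i \<in> {1..m} \<Longrightarrow> d dvd b i"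
  shows "qsum a b m n z = 0"
proof -
  obtain c where n: "n = d * c" using assms(2) by blast
  \<comment> \<open>\<open>A\<close> collects the factors that depend only on the quotient
    \<open>k div d\<close>.\<close>
  define A where "A s = of_nat ((c - 1) choose s) ^ 2 *
      (\<Prod>i=1..m. of_nat ((a i div d + s) choose (b i div d + s)) :: 'a)" for s
  have summand: "z ^ (k\<^sup>2 + 2 * k) * (qbinomial z (n - 1) k)\<^sup>2 *
      (\<Prod>i=1..m. qbinomial z (a i + k) (b i + k)) = A (k div d) * z ^ (k mod d)"
    if "k < n" for k
  proof -
    have td: "k mod d < d" using order_pos by simp
    have "0 < c" using that n by (cases c) auto
    \<comment> \<open>As \<open>d\<close> divides \<open>n\<close>, the number \<open>n - 1\<close>
      has quotient \<open>c - 1\<close> and the largest remainder \<open>d - 1\<close>.\<close>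
    then have n1: "n - 1 = (d - 1) + d * (c - 1)" using n order_pos by (cases c) auto
    have "(n - 1) div d = c - 1" "(n - 1) mod d = d - 1"
      unfolding n1 using order_pos by (simp_all only: div_mult_self2 mod_mult_self2) simp_all
    then have nk: "qbinomial z (n - 1) k =
        of_nat ((c - 1) choose (k div d)) * qbinomial z (d - 1) (k mod d)"
      by (subst q_Lucas) simp
    have "qbinomial z (a i + k) (b i + k) =
        of_nat ((a i div d + k div d) choose (b i div d + k div d))" if "i \<in> {1..m}" for i
    proof -
      \<comment> \<open>Both arguments have remainder \<open>k mod d\<close>, so the q-binomial left
        by \<open>q_Lucas\<close> is a diagonal entry, equal to 1.\<close>
      have *: "(x + k) div d = x div d + k div d" "(x + k) mod d = k mod d" if "d dvd x" for x
        using that order_pos by (auto elim!: dvdE)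
      show ?thesis
        by (subst q_Lucas) (simp add: * assms(3,4)[OF that] qbinomial_self)
    qed
    then have ab: "(\<Prod>i=1..m. qbinomial z (a i + k) (b i + k)) =
        (\<Prod>i=1..m. of_nat ((a i div d + k div d) choose (b i div d + k div d)))"
      by (intro prod.cong) auto
    have "(k\<^sup>2 + 2 * k) mod d = ((k mod d)\<^sup>2 + 2 * (k mod d)) mod d"
      by (intro mod_add_cong) (simp_all only: power_mod mod_mult_right_eq)
    then have "z ^ (k\<^sup>2 + 2 * k) = z ^ ((k mod d)\<^sup>2 + 2 * (k mod d))"
      using power_mod_order[of "k\<^sup>2 + 2 * k"]
        power_mod_order[of "(k mod d)\<^sup>2 + 2 * (k mod d)"] by (simp only:)
    then have "z ^ (k\<^sup>2 + 2 * k) * (qbinomial z (d - 1) (k mod d))\<^sup>2 = z ^ (k mod d)"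
      using qbinomial_pred_order_square[OF td] by (simp only:)
    then show ?thesis
      unfolding nk ab A_def power_mult_distrib by (simp only: ac_simps)
  qed
  have geometric: "(\<Sum>t<d. z ^ t) = 0"
    using power_diff_1_eq[of z d] power_order assms(1) by simp
  have "qsum a b m n z = (\<Sum>k<c * d. A (k div d) * z ^ (k mod d))"
    unfolding qsum_def using summand by (intro sum.cong) (auto simp: n mult.commute)
  \<comment> \<open>The range splits into \<open>c\<close> full blocks of length \<open>d\<close>,
    each contributing a multiple of the vanishing geometric sum.\<close>
  also have "\<dots> = (\<Sum>s<c. \<Sum>k\<in>{s * d..<s * d + d}. A (k div d) * z ^ (k mod d))"
    by (rule sum.nat_group[symmetric])
  also have "\<dots> = (\<Sum>s<c. \<Sum>t<d. A s * z ^ t)"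
  proof (rule sum.cong[OF refl])
    fix s
    have "(\<Sum>k\<in>{s * d..<s * d + d}. A (k div d) * z ^ (k mod d)) =
        (\<Sum>t\<in>{0..<d}. A ((t + s * d) div d) * z ^ ((t + s * d) mod d))"
      using sum.shift_bounds_nat_ivl[of "\<lambda>k. A (k div d) * z ^ (k mod d)" 0 "s * d" d]
      by (simp only: add_0 add.commute[of "s * d" d])
    also have "\<dots> = (\<Sum>t<d. A s * z ^ t)"
      unfolding atLeast0LessThan using order_pos by (intro sum.cong refl) simp
    finally show "(\<Sum>k\<in>{s * d..<s * d + d}. A (k div d) * z ^ (k mod d)) = (\<Sum>t<d. A s * z ^ t)" .
  qed
  also have "\<dots> = 0" by (simp add: geometric flip: sum_distrib_left)
  finally show ?thesis .
qed

section \<open>Integer polynomials and roots of unity\<close>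

text \<open>A predicate on polynomials over a larger ring, so that they can be evaluated directly at
  complex roots of unity.\<close>

definition int_coeffs :: "'a::ring_1 poly \<Rightarrow> bool" where
  "int_coeffs p \<longleftrightarrow> (\<forall>i. coeff p i \<in> \<int>)"

lemma int_coeffs_0: "int_coeffs 0"
  and int_coeffs_1: "int_coeffs 1"
  and int_coeffs_X: "int_coeffs [:0, 1:]"
  by (auto simp: int_coeffs_def coeff_pCons split: nat.split)

lemma int_coeffs_add: "int_coeffs p \<Longrightarrow> int_coeffs q \<Longrightarrow> int_coeffs (p + q)"
  by (simp add: int_coeffs_def)

lemma int_coeffs_mult:
  fixes p q :: "'a::comm_ring_1 poly"
  shows "int_coeffs p \<Longrightarrow> int_coeffs q \<Longrightarrow> int_coeffs (p * q)"
  by (auto simp: int_coeffs_def coeff_mult intro!: Ints_sum Ints_mult)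

lemma int_coeffs_power:
  fixes p :: "'a::comm_ring_1 poly"
  shows "int_coeffs p \<Longrightarrow> int_coeffs (p ^ n)"
  by (induction n) (auto intro: int_coeffs_1 int_coeffs_mult)

lemma int_coeffs_sum: "(\<And>i. i \<in> A \<Longrightarrow> int_coeffs (f i)) \<Longrightarrow> int_coeffs (sum f A)"
  by (induction A rule: infinite_finite_induct) (auto intro: int_coeffs_0 int_coeffs_add)

lemma int_coeffs_prod:
  fixes f :: "'b \<Rightarrow> 'a::comm_ring_1 poly"
  shows "(\<And>i. i \<in> A \<Longrightarrow> int_coeffs (f i)) \<Longrightarrow> int_coeffs (prod f A)"
  by (induction A rule: infinite_finite_induct) (auto intro: int_coeffs_1 int_coeffs_mult)

lemma int_coeffs_qbinomial:
  fixes p :: "'a::comm_ring_1 poly"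
  shows "int_coeffs p \<Longrightarrow> int_coeffs (qbinomial p n k)"
  by (induction p n k rule: qbinomial.induct)
    (auto simp del: power_Suc
      intro!: int_coeffs_0 int_coeffs_1 int_coeffs_add int_coeffs_mult int_coeffs_power)

lemma int_coeffs_qsum:
  fixes p :: "'a::comm_ring_1 poly"
  shows "int_coeffs p \<Longrightarrow> int_coeffs (qsum a b m n p)"
  unfolding qsum_def
  by (intro int_coeffs_sum int_coeffs_mult int_coeffs_power int_coeffs_prod int_coeffs_qbinomial)

lemma cis_root_powers:
  fixes g :: nat
  assumes "0 < g"
  defines "w \<equiv> cis (2 * pi / real g)"
  shows "w ^ g = 1" and "j < g \<Longrightarrow> w ^ j = 1 \<longleftrightarrow> j = 0"
proof -
  have power: "w ^ j = cis (2 * pi * real j / real g)" for j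
    by (simp add: w_def Complex.DeMoivre mult_ac)
  show "w ^ g = 1" using power[of g] assms(1) by simp
  have "bij_betw (\<lambda>k. cis (2 * pi * real k / real g)) {..<g} {z. z ^ g = 1}"
    using assms(1) by (rule bij_betw_roots_unity)
  then have "inj_on (\<lambda>k. cis (2 * pi * real k / real g)) {..<g}"
    by (rule bij_betw_imp_inj_on)
  then show "w ^ j = 1 \<longleftrightarrow> j = 0" if "j < g"
    using inj_onD[of "\<lambda>k. cis (2 * pi * real k / real g)" "{..<g}" j 0] that
    by (auto simp: power)
qed

text \<open>Roots-of-unity filter: summing \<open>p\<close> over all \<open>g\<close>-th roots of
  unity gives \<open>poly p 1\<close> by hypothesis, and \<open>g\<close> times a sum of
  coefficients by orthogonality.\<close>

lemma int_coeffs_dvd_value_at_1: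
  fixes p :: "complex poly" and g :: nat
  assumes "0 < g" "int_coeffs p"
    and zero: "\<And>z. z ^ g = 1 \<Longrightarrow> z \<noteq> 1 \<Longrightarrow> poly p z = 0"
  shows "\<exists>c. poly p 1 = of_nat g * of_int c"
proof -
  define w where "w = cis (2 * pi / real g)"
  note w = cis_root_powers[OF assms(1), folded w_def]
  have roots: "(w ^ j) ^ g = 1" for j
    by (metis w(1) mult.commute power_mult power_one)
  have sum_powers: "(\<Sum>j<g. (w ^ j) ^ i) \<in> {0, of_nat g}" for i
  proof (cases "w ^ i = 1")
    case True
    then have "(w ^ j) ^ i = 1" for j by (metis mult.commute power_mult power_one)
    then show ?thesis by simp
  next
    case False
    have "(\<Sum>j<g. (w ^ i) ^ j) = 0"
      using power_diff_1_eq[of "w ^ i" g] roots[of i] False by simp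
    then show ?thesis by (simp add: mult.commute flip: power_mult)
  qed
  have "poly p 1 = (\<Sum>j<g. poly p (w ^ j))"
  proof -
    have "(\<Sum>j<g. poly p (w ^ j)) = (\<Sum>j<g. if j = 0 then poly p 1 else 0)"
      using w(2) zero[OF roots] by (intro sum.cong) auto
    then show ?thesis using assms(1) by simp
  qed
  also have "\<dots> = (\<Sum>i\<le>degree p. coeff p i * (\<Sum>j<g. (w ^ j) ^ i))"
    unfolding poly_altdef sum_distrib_left by (rule sum.swap)
  \<comment> \<open>The \<open>if\<close> selects the indices with \<open>w ^ i = 1\<close>, for
    which the power sum is \<open>g\<close> and not 0.\<close>
  also have "\<dots> = of_nat g *
      (\<Sum>i\<le>degree p. if (\<Sum>j<g. (w ^ j) ^ i) = 0 then 0 else coeff p i)"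
    unfolding sum_distrib_left[of "of_nat g"]
  proof (intro sum.cong refl)
    fix i
    show "coeff p i * (\<Sum>j<g. (w ^ j) ^ i) =
        of_nat g * (if (\<Sum>j<g. (w ^ j) ^ i) = 0 then 0 else coeff p i)"
      using sum_powers[of i] by auto
  qed
  finally have "poly p 1 = of_nat g *
      (\<Sum>i\<le>degree p. if (\<Sum>j<g. (w ^ j) ^ i) = 0 then 0 else coeff p i)" .
  moreover have "(\<Sum>i\<le>degree p. if (\<Sum>j<g. (w ^ j) ^ i) = 0 then 0 else coeff p i) \<in> \<int>"
    using assms(2) by (intro Ints_sum) (auto simp: int_coeffs_def)
  ultimately show ?thesis by (auto elim: Ints_cases)
qed

theorem theorem1p4:
  fixes a b :: "nat \<Rightarrow> nat" and m n :: nat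
  assumes "n > 0"
  shows "[(\<Sum>k=0..n-1. ((n - 1) choose k)\<^sup>2 * (\<Prod>i=1..m. (a i + k) choose (b i + k))) = 0]
           (mod Gcd (a ` {1..m} \<union> b ` {1..m} \<union> {n}))"
proof -
  define g where "g = Gcd (a ` {1..m} \<union> b ` {1..m} \<union> {n})"
  define S where "S = (\<Sum>k<n. ((n - 1) choose k)\<^sup>2 * (\<Prod>i=1..m. (a i + k) choose (b i + k)))"
  define F :: "complex poly" where "F = qsum a b m n [:0, 1:]"
  have gdvd: "g dvd x" if "x \<in> a ` {1..m} \<union> b ` {1..m} \<union> {n}" for x
    unfolding g_def using that by (rule Gcd_dvd)
  have "0 < g" using gdvd[of n] assms by (auto intro: gr0I)
  have "\<exists>c. poly F 1 = of_nat g * of_int c"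
  proof (rule int_coeffs_dvd_value_at_1[OF \<open>0 < g\<close>])
    show "int_coeffs F" unfolding F_def by (intro int_coeffs_qsum int_coeffs_X)
    fix z :: complex
    assume z: "z ^ g = 1" "z \<noteq> 1"
    obtain d where "root_of_unity z d" using root_of_unity_exists[OF z(1) \<open>0 < g\<close>] .
    then interpret root_of_unity z d .
    \<comment> \<open>The order of \<open>z\<close> divides \<open>g\<close>, hence \<open>n\<close>
      and every \<open>a i\<close> and \<open>b i\<close>.\<close>
    have "d dvd x" if "x \<in> a ` {1..m} \<union> b ` {1..m} \<union> {n}" for x
      using order_dvd[OF z(1)] gdvd[OF that] by (rule dvd_trans)
    then have "qsum a b m n z = 0" by (intro qsum_eq_0 z(2)) auto
    then show "poly F z = 0" by (simp add: F_def poly_qsum)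
  qed
  then obtain c where "poly F 1 = of_nat g * of_int c" by blast
  moreover have "poly F 1 = of_nat S" by (simp add: F_def poly_qsum qsum_1 S_def)
  \<comment> \<open>The equation holds in the complex numbers; injectivity of \<open>of_int\<close>
    brings it back to the integers.\<close>
  ultimately have "(of_int (int S) :: complex) = of_int (int g * c)" by simp
  then have "int S = int g * c" by (simp only: of_int_eq_iff)
  then have "g dvd S" by (metis dvd_triv_left of_nat_dvd_iff)
  moreover have "{0..n-1} = {..<n}" using assms by auto
  ultimately show ?thesis by (simp add: cong_0_iff g_def S_def)
qed

end
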